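(* Let $T_1,T_2\in\mathcal{B}_A(\mathcal{H})$ and let $i$ denote the imaginary unit when it multiplies an operator. Then $$w_{\mathbb{A}}\left(\begin{bmatrix}T_1&T_2\\ T_2&iT_1\end{bmatrix}\right)\le w_A(T_1)+w_A(T_2).$$
   Context: $\mathcal{H}$ is a complex Hilbert space with inner product $\langle\cdot,\cdot\rangle$, $\mathcal{B}(\mathcal{H})$ is the algebra of bounded linear operators on $\mathcal{H}$, and $A\in\mathcal{B}(\mathcal{H})$ is a fixed positive operator ($\langle Ax,x\rangle\ge 0$ for all $x$). Put $\langle x,y\rangle_A=\langle Ax,y\rangle$ and $\|x\|_A=\sqrt{\langle x,x\rangle_A}$. $\mathcal{B}_A(\mathcal{H})$ is the set of $T\in\mathcal{B}(\mathcal{H})$ admitting an $A$-adjoint, i.e. for which there is $X\in\mathcal{B}(\mathcal{H})$ with $AX=T^*A$ (equivalently $\mathcal{R}(T^*A)\subseteq\mathcal{R}(A)$). The $A$-numerical radius is $w_A(T)=\sup\{|\langle Tx,x\rangle_A|: x\in\mathcal{H},\ \|x\|_A=1\}$. $\mathbb{A}=\begin{bmatrix}A&O\\O&A\end{bmatrix}$ on $\mathcal{H}\oplus\mathcal{H}$, and $w_{\mathbb{A}}$ is the numerical radius defined in the same way with $\mathcal{H},A$ replaced by $\mathcal{H}\oplus\mathcal{H},\mathbb{A}$. *)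

theory Defs
  imports "HOL-Analysis.Analysis" "HOL-Library.Extended_Nonnegative_Real"
    "HOL-Library.Nonpos_Ints"
begin

class complex_vector = real_vector +
  fixes scaleC :: "complex \<Rightarrow> 'a \<Rightarrow> 'a" (infixr "*\<^sub>C" 75)
  assumes scaleC_add_right: "c *\<^sub>C (x + y) = c *\<^sub>C x + c *\<^sub>C y"
    and scaleC_add_left: "(c + d) *\<^sub>C x = c *\<^sub>C x + d *\<^sub>C x"
    and scaleC_scaleC: "c *\<^sub>C d *\<^sub>C x = (c * d) *\<^sub>C x"
    and scaleC_one: "1 *\<^sub>C x = x"
    and scaleR_scaleC: "r *\<^sub>R x = complex_of_real r *\<^sub>C x"

text \<open>The inner product is linear in the first argument.  Basing the class on \<^class>\<open>banach\<close>
  supplies completeness; the norm axioms it also contains follow from the inner product axioms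
  and so restrict nothing.\<close>

class chilbert_space = complex_vector + banach +
  fixes cinner :: "'a \<Rightarrow> 'a \<Rightarrow> complex"
  assumes cinner_commute: "cinner x y = cnj (cinner y x)"
    and cinner_add_left: "cinner (x + y) z = cinner x z + cinner y z"
    and cinner_scaleC_left: "cinner (c *\<^sub>C x) y = c * cinner x y"
    and cinner_ge_zero: "cinner x x \<in> \<real>\<^sub>\<ge>\<^sub>0"
    and cinner_eq_zero_iff: "cinner x x = 0 \<longleftrightarrow> x = 0"
    and norm_eq_sqrt_cinner: "norm x = sqrt (Re (cinner x x))"

text \<open>The orthogonal sum of two Hilbert spaces is their product type; its norm is the one that
  the library already puts on products.\<close>

instantiation prod :: (complex_vector, complex_vector) complex_vector
begin

definition scaleC_prod_def: "scaleC c p = (c *\<^sub>C fst p, c *\<^sub>C snd p)"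

instance
  by standard
    (auto simp: scaleC_prod_def prod_eq_iff scaleC_add_right scaleC_add_left scaleC_scaleC
      scaleC_one scaleR_scaleC)

end

instantiation prod :: (chilbert_space, chilbert_space) chilbert_space
begin

definition cinner_prod_def: "cinner p q = cinner (fst p) (fst q) + cinner (snd p) (snd q)"

instance
proof
  fix x y z :: "'a \<times> 'b" and c :: complex
  have nn: "Re (cinner a a) \<ge> 0" "Im (cinner a a) = 0" for a :: "'c::chilbert_space"
    using cinner_ge_zero[of a] by (auto simp: nonneg_Reals_def)
  have z: "cinner a a = 0 \<longleftrightarrow> Re (cinner a a) = 0" for a :: "'c::chilbert_space"
    using nn[of a] by (auto simp: complex_eq_iff)
  show "cinner x y = cnj (cinner y x)"
    unfolding cinner_prod_def complex_cnj_add using cinner_commute by metis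
  show "cinner (x + y) z = cinner x z + cinner y z"
    by (simp add: cinner_prod_def cinner_add_left)
  show "cinner (c *\<^sub>C x) y = c * cinner x y"
    by (simp add: cinner_prod_def scaleC_prod_def cinner_scaleC_left distrib_left)
  show "cinner x x \<in> \<real>\<^sub>\<ge>\<^sub>0"
    unfolding cinner_prod_def by (intro nonneg_Reals_add_I cinner_ge_zero)
  show "cinner x x = 0 \<longleftrightarrow> x = 0"
  proof -
    have "cinner x x = 0 \<longleftrightarrow> Re (cinner (fst x) (fst x)) = 0 \<and> Re (cinner (snd x) (snd x)) = 0"
      using nn[of "fst x"] nn[of "snd x"]
      by (auto simp: cinner_prod_def complex_eq_iff add_nonneg_eq_0_iff)
    then show ?thesis
      by (simp add: z[symmetric] cinner_eq_zero_iff prod_eq_iff)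
  qed
  show "norm x = sqrt (Re (cinner x x))"
    using nn[of "fst x"] nn[of "snd x"] by (simp add: norm_prod_def norm_eq_sqrt_cinner cinner_prod_def)
qed

end

definition bounded_clinear :: "('a::chilbert_space \<Rightarrow> 'a) \<Rightarrow> bool" where
  "bounded_clinear T \<longleftrightarrow> bounded_linear T \<and> (\<forall>c x. T (c *\<^sub>C x) = c *\<^sub>C T x)"

text \<open>The Hilbert space adjoint, which exists for every bounded complex-linear operator by the
  Riesz representation theorem.\<close>

definition cadjoint :: "('a::chilbert_space \<Rightarrow> 'a) \<Rightarrow> 'a \<Rightarrow> 'a" where
  "cadjoint T = (THE S. \<forall>x y. cinner (T x) y = cinner x (S y))"

definition positive_op :: "('a::chilbert_space \<Rightarrow> 'a) \<Rightarrow> bool" where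
  "positive_op A \<longleftrightarrow> bounded_clinear A \<and> (\<forall>x. cinner (A x) x \<in> \<real>\<^sub>\<ge>\<^sub>0)"

definition A_inner :: "('a::chilbert_space \<Rightarrow> 'a) \<Rightarrow> 'a \<Rightarrow> 'a \<Rightarrow> complex" where
  "A_inner A x y = cinner (A x) y"

definition A_norm :: "('a::chilbert_space \<Rightarrow> 'a) \<Rightarrow> 'a \<Rightarrow> real" where
  "A_norm A x = sqrt (Re (A_inner A x x))"

definition A_adjointable :: "('a::chilbert_space \<Rightarrow> 'a) \<Rightarrow> ('a \<Rightarrow> 'a) set" where
  "A_adjointable A =
    {T. bounded_clinear T \<and> (\<exists>X. bounded_clinear X \<and> A \<circ> X = cadjoint T \<circ> A)}"

text \<open>The supremum is taken in \<open>[0, \<infinity>]\<close>, so that it is meaningful for every operator \<open>T\<close>,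
  also for one that is not bounded with respect to the seminorm, and is \<open>0\<close> if \<open>A = 0\<close>, when no
  vector has seminorm \<open>1\<close>.\<close>

definition A_numerical_radius :: "('a::chilbert_space \<Rightarrow> 'a) \<Rightarrow> ('a \<Rightarrow> 'a) \<Rightarrow> ennreal" where
  "A_numerical_radius A T = (SUP x\<in>{x. A_norm A x = 1}. ennreal (cmod (A_inner A (T x) x)))"

text \<open>\<open>block_op P Q R S\<close> is the operator matrix with rows \<open>(P, Q)\<close> and \<open>(R, S)\<close>.\<close>

definition block_op ::
  "('a::chilbert_space \<Rightarrow> 'a) \<Rightarrow> ('a \<Rightarrow> 'a) \<Rightarrow> ('a \<Rightarrow> 'a) \<Rightarrow> ('a \<Rightarrow> 'a) \<Rightarrow> 'a \<times> 'a \<Rightarrow> 'a \<times> 'a" where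
  "block_op P Q R S = (\<lambda>(x, y). (P x + Q y, R x + S y))"

end

theory Submission
  imports Defs
begin

text \<open>Let \<open>(x, y)\<close> be a vector with \<open>\<parallel>x\<parallel>\<^sub>A\<^sup>2 + \<parallel>y\<parallel>\<^sub>A\<^sup>2 = 1\<close>.  The quadratic form of the operator matrix
  at \<open>(x, y)\<close> is the sum of a diagonal part \<open>\<langle>T\<^sub>1 x, x\<rangle>\<^sub>A + \<i> \<langle>T\<^sub>1 y, y\<rangle>\<^sub>A\<close> and an off-diagonal part
  \<open>\<langle>T\<^sub>2 y, x\<rangle>\<^sub>A + \<langle>T\<^sub>2 x, y\<rangle>\<^sub>A\<close>.  Both are combinations of values of the quadratic forms of \<open>T\<^sub>1\<close> and
  \<open>T\<^sub>2\<close>: the first one visibly so, and the second one because polarization makes it half of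
  \<open>\<langle>T\<^sub>2 (x + y), x + y\<rangle>\<^sub>A - \<langle>T\<^sub>2 (x - y), x - y\<rangle>\<^sub>A\<close>.  By homogeneity
  \<open>\<bar>\<langle>T z, z\<rangle>\<^sub>A\<bar> \<le> w\<^sub>A(T) \<parallel>z\<parallel>\<^sub>A\<^sup>2\<close> for every \<open>z\<close>
  (\<open>quadratic_form_le_A_numerical_radius\<close>), so the diagonal part is at most \<open>w\<^sub>A(T\<^sub>1)\<close>, and the
  off-diagonal part is at most \<open>w\<^sub>A(T\<^sub>2)\<close> by the parallelogram law.

  Homogeneity says nothing about vectors \<open>z\<close> of seminorm \<open>0\<close>, and these do occur (already when
  \<open>x = y\<close>).  For them the form vanishes since \<open>A\<close> is positive
  (\<open>A_inner_eq_0_if_A_norm_eq_0\<close>).\<close>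

section \<open>Sesquilinearity\<close>

lemma cinner_add_right: "cinner x (y + z) = cinner x y + cinner x z"
  by (metis cinner_add_left cinner_commute complex_cnj_add)

lemma cinner_scaleC_right: "cinner x (c *\<^sub>C y) = cnj c * cinner x y"
  by (metis cinner_commute cinner_scaleC_left complex_cnj_mult)

lemma cinner_diff_left: "cinner (x - y) z = cinner x z - cinner y z"
  using cinner_add_left[of "x - y" y z] by simp

lemma cinner_diff_right: "cinner x (y - z) = cinner x y - cinner x z"
  using cinner_add_right[of x "y - z" z] by simp

lemma
  assumes "bounded_clinear T"
  shows bounded_clinear_add: "T (x + y) = T x + T y"
    and bounded_clinear_diff: "T (x - y) = T x - T y"
    and bounded_clinear_scaleC: "T (c *\<^sub>C x) = c *\<^sub>C T x"
  using assms
  by (simp_all add: bounded_clinear_def linear_add linear_diff bounded_linear.linear)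

lemmas sesquilinear_simps = A_inner_def bounded_clinear_add bounded_clinear_diff
  bounded_clinear_scaleC cinner_add_left cinner_add_right cinner_diff_left cinner_diff_right
  cinner_scaleC_left cinner_scaleC_right

section \<open>The seminorm of a positive operator\<close>

lemma positive_op_bounded_clinear: "positive_op A \<Longrightarrow> bounded_clinear A"
  by (simp add: positive_op_def)

lemma
  assumes "positive_op A"
  shows Re_A_inner_self_nonneg: "0 \<le> Re (A_inner A x x)"
    and Im_A_inner_self: "Im (A_inner A x x) = 0"
  using assms by (auto simp: positive_op_def A_inner_def complex_nonneg_Reals_iff)

lemma A_norm_power2:
  assumes "positive_op A"
  shows "(A_norm A x)\<^sup>2 = Re (A_inner A x x)"
  using Re_A_inner_self_nonneg[OF assms] by (simp add: A_norm_def)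

lemma A_norm_nonneg:
  assumes "positive_op A"
  shows "0 \<le> A_norm A x"
  using Re_A_inner_self_nonneg[OF assms] by (simp add: A_norm_def)

lemma A_norm_parallelogram_law:
  assumes "positive_op A"
  shows "(A_norm A (x + y))\<^sup>2 + (A_norm A (x - y))\<^sup>2 = 2 * (A_norm A x)\<^sup>2 + 2 * (A_norm A y)\<^sup>2"
  using positive_op_bounded_clinear[OF assms]
  by (simp add: A_norm_power2[OF assms] sesquilinear_simps)

text \<open>This is a degenerate case of the Cauchy-Schwarz inequality.  If \<open>\<langle>x, x\<rangle>\<^sub>A = 0\<close>, then the
  nonnegative number \<open>\<langle>u + t d x, u + t d x\<rangle>\<^sub>A\<close> depends on the real number \<open>t\<close> in an affine way, so
  its slope is \<open>0\<close>.  The direction \<open>d = 1\<close> gives \<open>\<langle>u, x\<rangle>\<^sub>A + \<langle>x, u\<rangle>\<^sub>A = 0\<close>, and \<open>d = \<i>\<close> gives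
  \<open>\<langle>u, x\<rangle>\<^sub>A = \<langle>x, u\<rangle>\<^sub>A\<close>.\<close>

lemma A_inner_eq_0_if_A_norm_eq_0:
  assumes A: "positive_op A" and x: "A_norm A x = 0"
  shows "A_inner A u x = 0"
proof -
  let ?p = "A_inner A u x" and ?q = "A_inner A x u"
  have x0: "A_inner A x x = 0"
    using A_norm_power2[OF A, of x] Im_A_inner_self[OF A, of x] x by (simp add: complex_eq_iff)
  have slope: "cnj d * ?p + d * ?q = 0" for d
  proof -
    have expand: "A_inner A (u + c *\<^sub>C x) (u + c *\<^sub>C x) = A_inner A u u + (cnj c * ?p + c * ?q)" for c
      using x0 positive_op_bounded_clinear[OF A] by (simp add: sesquilinear_simps algebra_simps)
    have im: "Im (cnj d * ?p + d * ?q) = 0"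
      using Im_A_inner_self[OF A, of "u + d *\<^sub>C x"] Im_A_inner_self[OF A, of u]
      by (simp add: expand)
    define r where "r = Re (cnj d * ?p + d * ?q)"
    have affine: "0 \<le> Re (A_inner A u u) + t * r" for t
    proof -
      have "cnj (of_real t * d) * ?p + (of_real t * d) * ?q = of_real t * (cnj d * ?p + d * ?q)"
        by (simp add: algebra_simps)
      then show ?thesis
        using Re_A_inner_self_nonneg[OF A, of "u + (of_real t * d) *\<^sub>C x"]
        unfolding expand r_def by simp
    qed
    have "r = 0"
    proof (rule ccontr)
      assume "r \<noteq> 0"
      \<comment> \<open>At this value of \<open>t\<close> the affine function equals \<open>-1\<close>.\<close>
      then show False
        using affine[of "- (Re (A_inner A u u) + 1) / r"] by simp
    qed
    with im show ?thesis
      by (simp add: r_def complex_eq_iff)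
  qed
  have "?p + ?q = 0"
    using slope[of 1] by simp
  moreover have "?p = ?q"
    using slope[of \<i>] by (simp flip: right_diff_distrib)
  ultimately show ?thesis
    by simp
qed

section \<open>The numerical radius bounds the quadratic form\<close>

text \<open>A vector of positive seminorm is a multiple of one of seminorm \<open>1\<close>, and both sides scale
  alike.  On the others the left side is \<open>0\<close>, which the right side must match even when the
  numerical radius is infinite: in \<open>[0, \<infinity>]\<close> the product \<open>\<infinity> * 0\<close> is \<open>0\<close>.\<close>

lemma quadratic_form_le_A_numerical_radius:
  assumes A: "positive_op A" and T: "bounded_clinear T"
  shows "ennreal (cmod (A_inner A (T x) x)) \<le> A_numerical_radius A T * ennreal ((A_norm A x)\<^sup>2)"
proof (cases "A_norm A x = 0")
  case True
  then show ?thesis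
    by (simp add: A_inner_eq_0_if_A_norm_eq_0[OF A])
next
  case False
  define r where "r = A_norm A x"
  define z where "z = complex_of_real (1 / r) *\<^sub>C x"
  have r: "0 < r"
    using False A_norm_nonneg[OF A, of x] by (simp add: r_def)
  have x: "x = complex_of_real r *\<^sub>C z"
    using r by (simp add: z_def scaleC_scaleC scaleC_one)
  have "(A_norm A x)\<^sup>2 = r\<^sup>2 * (A_norm A z)\<^sup>2"
    using positive_op_bounded_clinear[OF A] unfolding A_norm_power2[OF A]
    by (subst (1 2) x) (simp add: sesquilinear_simps power2_eq_square)
  then have "A_norm A z = 1"
    using r A_norm_nonneg[OF A, of z] by (simp add: power2_eq_1_iff flip: r_def)
  then have "ennreal (cmod (A_inner A (T z) z)) \<le> A_numerical_radius A T"
    unfolding A_numerical_radius_def by (intro SUP_upper) simp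
  moreover have "cmod (A_inner A (T x) x) = cmod (A_inner A (T z) z) * r\<^sup>2"
    using positive_op_bounded_clinear[OF A] T r
    by (subst (1 2) x) (simp add: sesquilinear_simps norm_mult power2_eq_square)
  ultimately show ?thesis
    by (simp add: ennreal_mult mult_right_mono flip: r_def)
qed

lemma diagonal_form_le_A_numerical_radius:
  assumes "positive_op A" and "bounded_clinear T" and "cmod c = 1"
  shows "ennreal (cmod (A_inner A (T x) x + c * A_inner A (T y) y))
    \<le> A_numerical_radius A T * ennreal ((A_norm A x)\<^sup>2 + (A_norm A y)\<^sup>2)"
proof -
  have "cmod (A_inner A (T x) x + c * A_inner A (T y) y)
      \<le> cmod (A_inner A (T x) x) + cmod (A_inner A (T y) y)"
    using norm_triangle_ineq[of "A_inner A (T x) x" "c * A_inner A (T y) y"] assms(3)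
    by (simp add: norm_mult)
  then have "ennreal (cmod (A_inner A (T x) x + c * A_inner A (T y) y))
      \<le> ennreal (cmod (A_inner A (T x) x)) + ennreal (cmod (A_inner A (T y) y))"
    by (simp add: ennreal_leI flip: ennreal_plus)
  also have "\<dots> \<le> A_numerical_radius A T * ennreal ((A_norm A x)\<^sup>2)
      + A_numerical_radius A T * ennreal ((A_norm A y)\<^sup>2)"
    by (intro add_mono quadratic_form_le_A_numerical_radius assms)
  finally show ?thesis
    by (simp add: distrib_left)
qed

text \<open>Polarization expresses twice the off-diagonal form at \<open>(x, y)\<close> as a diagonal form at
  \<open>(x + y, x - y)\<close>, and the parallelogram law says that the squared seminorms double as well.\<close>

lemma off_diagonal_form_le_A_numerical_radius:
  assumes A: "positive_op A" and T: "bounded_clinear T"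
  shows "ennreal (cmod (A_inner A (T y) x + A_inner A (T x) y))
    \<le> A_numerical_radius A T * ennreal ((A_norm A x)\<^sup>2 + (A_norm A y)\<^sup>2)"
    (is "ennreal (cmod ?f) \<le> ?w * ennreal ?s")
proof -
  have "A_inner A (T (x + y)) (x + y) + (- 1) * A_inner A (T (x - y)) (x - y) = 2 * ?f"
    using positive_op_bounded_clinear[OF A] T by (simp add: sesquilinear_simps algebra_simps)
  then have "ennreal (cmod (2 * ?f)) \<le> ?w * ennreal (2 * ?s)"
    using diagonal_form_le_A_numerical_radius[OF A T, of "- 1" "x + y" "x - y"]
    by (simp add: A_norm_parallelogram_law[OF A] distrib_left)
  moreover have "ennreal (cmod (2 * ?f)) = 2 * ennreal (cmod ?f)"
    unfolding norm_mult by (simp add: ennreal_mult)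
  moreover have "ennreal (2 * ?s) = 2 * ennreal ?s"
    by (rule ennreal_mult[of 2 ?s, simplified ennreal_numeral]) simp_all
  ultimately have "2 * ennreal (cmod ?f) \<le> 2 * (?w * ennreal ?s)"
    by (metis mult.left_commute)
  then show ?thesis
    by (simp add: ennreal_mult_le_mult_iff)
qed

section \<open>The operator matrix\<close>

lemma A_inner_block_diagonal:
  "A_inner (block_op A (\<lambda>_. 0) (\<lambda>_. 0) A) p q = A_inner A (fst p) (fst q) + A_inner A (snd p) (snd q)"
  by (simp add: A_inner_def block_op_def cinner_prod_def case_prod_unfold)

theorem proposition4p1:
  fixes A T\<^sub>1 T\<^sub>2 :: "'a::chilbert_space \<Rightarrow> 'a"
  assumes "positive_op A"
    and "T\<^sub>1 \<in> A_adjointable A"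
    and "T\<^sub>2 \<in> A_adjointable A"
  shows "A_numerical_radius (block_op A (\<lambda>_. 0) (\<lambda>_. 0) A)
      (block_op T\<^sub>1 T\<^sub>2 T\<^sub>2 (\<lambda>x. \<i> *\<^sub>C T\<^sub>1 x))
    \<le> A_numerical_radius A T\<^sub>1 + A_numerical_radius A T\<^sub>2"
proof -
  let ?A = "block_op A (\<lambda>_. 0) (\<lambda>_. 0) A"
  let ?T = "block_op T\<^sub>1 T\<^sub>2 T\<^sub>2 (\<lambda>x. \<i> *\<^sub>C T\<^sub>1 x)"
  have T: "bounded_clinear T\<^sub>1" "bounded_clinear T\<^sub>2"
    using assms by (auto simp: A_adjointable_def)
  have "ennreal (cmod (A_inner ?A (?T p) p)) \<le> A_numerical_radius A T\<^sub>1 + A_numerical_radius A T\<^sub>2"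
    if p: "A_norm ?A p = 1" for p
  proof -
    obtain x y where xy: "p = (x, y)"
      by (cases p)
    let ?D = "A_inner A (T\<^sub>1 x) x + \<i> * A_inner A (T\<^sub>1 y) y"
    let ?F = "A_inner A (T\<^sub>2 y) x + A_inner A (T\<^sub>2 x) y"
    have unit: "(A_norm A x)\<^sup>2 + (A_norm A y)\<^sup>2 = 1"
      using p by (simp add: xy A_norm_power2[OF assms(1)] A_norm_def[of ?A] A_inner_block_diagonal)
    have "A_inner ?A (?T p) p = ?D + ?F"
      using positive_op_bounded_clinear[OF assms(1)]
      unfolding xy A_inner_block_diagonal
      by (simp add: block_op_def sesquilinear_simps)
    then have "ennreal (cmod (A_inner ?A (?T p) p)) \<le> ennreal (cmod ?D) + ennreal (cmod ?F)"
      by (simp add: norm_triangle_ineq ennreal_leI flip: ennreal_plus)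
    also have "\<dots> \<le> A_numerical_radius A T\<^sub>1 + A_numerical_radius A T\<^sub>2"
      using diagonal_form_le_A_numerical_radius[OF assms(1) T(1), of \<i> x y]
        off_diagonal_form_le_A_numerical_radius[OF assms(1) T(2), of y x]
      by (intro add_mono) (simp_all add: unit)
    finally show ?thesis .
  qed
  then show ?thesis
    unfolding A_numerical_radius_def[of ?A] by (intro SUP_least) simp
qed

end
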